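(* Let $\{f(\cdot\mid\theta):\theta\in\Theta\}$, $\Theta\subseteq\mathbb{R}$, be a parametric family of densities, let $x_1,\dots,x_T$ be data with $f(x_t\mid\theta)>0$ for all $t$ and $\theta$, and let $H_0$ be either a singleton $\{\theta_0\}\subseteq\Theta$ (pre-change parameter known) or $H_0=\Theta$ (pre-change parameter unknown). Then for any integers $0\le\tau_1<\tau_2<\dots<\tau_n<T$ such that all the maxima defining the quantities below exist, $$\max_{i=1,\dots,n} m_{\tau_i,T}\;\le\;\sum_{i=1}^{n-1} m_{\tau_i,\tau_{i+1}}+m_{\tau_n,T}.$$
   Context: For $0\le\tau\le u\le T$, the log-likelihood of $x_{1:u}=(x_1,\dots,x_u)$ with pre-change parameter $\theta_0$, post-change parameter $\theta_1$ and change at $\tau$ is $$\ell(x_{1:u}\vert\theta_0,\theta_1,\tau)=\sum_{t=1}^{\tau}\log f(x_t\mid\theta_0)+\sum_{t=\tau+1}^{u}\log f(x_t\mid\theta_1),$$ and $\ell(x_{1:u}\vert\theta_0,\cdot,u)=\sum_{t=1}^{u}\log f(x_t\mid\theta_0)$; empty sums are $0$. For $0\le s<u\le T$ define $$m_{s,u}=\max_{\theta_0\in H_0,\ \theta_1\in\Theta}\ell(x_{1:u}\vert\theta_0,\theta_1,s)-\max_{\theta_0\in H_0}\ell(x_{1:u}\vert\theta_0,\cdot,u).$$ *)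

theory Defs
  imports "HOL-Analysis.Analysis"
begin

text \<open>The value \<open>f y \<theta>\<close> stands for \<open>f(y | \<theta>)\<close>. The dominating measure \<open>M\<close> on the
  observation space is arbitrary, so that continuous (Lebesgue measure) and discrete (counting
  measure) models are both covered.\<close>

definition density_family :: "'a measure \<Rightarrow> real set \<Rightarrow> ('a \<Rightarrow> real \<Rightarrow> real) \<Rightarrow> bool" where
  "density_family M \<Theta> f \<longleftrightarrow>
     (\<forall>\<theta>\<in>\<Theta>. (\<lambda>y. f y \<theta>) \<in> borel_measurable M \<and> (\<forall>y\<in>space M. 0 \<le> f y \<theta>) \<and>
            (\<integral>\<^sup>+ y. ennreal (f y \<theta>) \<partial>M) = 1)"

text \<open>The data are \<open>x 1, \<dots>, x T\<close>; other values of \<open>x\<close> are irrelevant.\<close>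

definition loglik :: "('a \<Rightarrow> real \<Rightarrow> real) \<Rightarrow> (nat \<Rightarrow> 'a) \<Rightarrow> nat \<Rightarrow> real \<Rightarrow> real \<Rightarrow> nat \<Rightarrow> real" where
  "loglik f x u \<theta>0 \<theta>1 \<tau> = (\<Sum>t=1..\<tau>. ln (f (x t) \<theta>0)) + (\<Sum>t=\<tau>+1..u. ln (f (x t) \<theta>1))"

text \<open>The log-likelihood \<open>\<ell>(x\<^sub>1, \<dots>, x\<^sub>u | \<theta>0, \<cdot>, u)\<close> without a change.\<close>

definition loglik_null :: "('a \<Rightarrow> real \<Rightarrow> real) \<Rightarrow> (nat \<Rightarrow> 'a) \<Rightarrow> nat \<Rightarrow> real \<Rightarrow> real" where
  "loglik_null f x u \<theta>0 = (\<Sum>t=1..u. ln (f (x t) \<theta>0))"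

definition has_maximum :: "real set \<Rightarrow> bool" where
  "has_maximum S \<longleftrightarrow> (\<exists>y\<in>S. \<forall>z\<in>S. z \<le> y)"

text \<open>The library's \<open>Max\<close> is only meaningful for finite sets. The value below is the greatest element
  of \<open>S\<close> if \<open>has_maximum S\<close>, and unspecified otherwise.\<close>

definition maximum :: "real set \<Rightarrow> real" where
  "maximum S = (GREATEST y. y \<in> S)"

definition alt_logliks ::
  "('a \<Rightarrow> real \<Rightarrow> real) \<Rightarrow> (nat \<Rightarrow> 'a) \<Rightarrow> real set \<Rightarrow> real set \<Rightarrow> nat \<Rightarrow> nat \<Rightarrow> real set" where
  "alt_logliks f x \<Theta> H0 s u = {loglik f x u \<theta>0 \<theta>1 s | \<theta>0 \<theta>1. \<theta>0 \<in> H0 \<and> \<theta>1 \<in> \<Theta>}"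

definition null_logliks :: "('a \<Rightarrow> real \<Rightarrow> real) \<Rightarrow> (nat \<Rightarrow> 'a) \<Rightarrow> real set \<Rightarrow> nat \<Rightarrow> real set" where
  "null_logliks f x H0 u = {loglik_null f x u \<theta>0 | \<theta>0. \<theta>0 \<in> H0}"

definition lr_stat ::
  "('a \<Rightarrow> real \<Rightarrow> real) \<Rightarrow> (nat \<Rightarrow> 'a) \<Rightarrow> real set \<Rightarrow> real set \<Rightarrow> nat \<Rightarrow> nat \<Rightarrow> real" where
  "lr_stat f x \<Theta> H0 s u = maximum (alt_logliks f x \<Theta> H0 s u) - maximum (null_logliks f x H0 u)"

text \<open>Both maxima in the definition of \<open>lr_stat\<close> are attained.\<close>

definition lr_stat_exists ::
  "('a \<Rightarrow> real \<Rightarrow> real) \<Rightarrow> (nat \<Rightarrow> 'a) \<Rightarrow> real set \<Rightarrow> real set \<Rightarrow> nat \<Rightarrow> nat \<Rightarrow> bool" where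
  "lr_stat_exists f x \<Theta> H0 s u \<longleftrightarrow>
     has_maximum (alt_logliks f x \<Theta> H0 s u) \<and> has_maximum (null_logliks f x H0 u)"

end

theory Submission
  imports Defs
begin

text \<open>Every statistic \<open>m s u\<close> is nonnegative, since taking \<open>\<theta>1 = \<theta>0\<close> in the
  alternative recovers the null model. Moreover \<open>m a T \<le> m a b + m b T\<close> for
  \<open>a \<le> b \<le> T\<close>: cut the optimal alternative with change at \<open>a\<close> at time \<open>b\<close>; its first
  part competes in \<open>m a b\<close>, and its second part, preceded by the best null model up to \<open>b\<close>,
  competes in \<open>m b T\<close>, the null maximum at \<open>b\<close> cancelling. Chaining this inequality
  along \<open>\<tau> i, \<dots>, \<tau> n\<close> and adding the nonnegative earlier terms gives the claim.\<close>

text \<open>The sole access to \<open>maximum\<close> below: as a \<open>GREATEST\<close> term it is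
  unspecified unless the maximum is attained.\<close>

lemma maximum_in_and_ge:
  assumes "has_maximum S"
  shows "maximum S \<in> S" and "\<And>y. y \<in> S \<Longrightarrow> y \<le> maximum S"
proof -
  obtain y where "y \<in> S" "\<And>z. z \<in> S \<Longrightarrow> z \<le> y"
    using assms by (auto simp: has_maximum_def)
  moreover from this have "maximum S = y"
    unfolding maximum_def by (intro Greatest_equality) auto
  ultimately show "maximum S \<in> S" and "\<And>y. y \<in> S \<Longrightarrow> y \<le> maximum S"
    by auto
qed

text \<open>Isolates the pre-change part, so that it can cancel against a null maximum taken at the
  change point.\<close>

lemma loglik_eq_loglik_null_add:
  "loglik f x u \<theta>0 \<theta>1 s = loglik_null f x s \<theta>0 + (\<Sum>t=s+1..u. ln (f (x t) \<theta>1))"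
  by (simp add: loglik_def loglik_null_def)

lemma loglik_split:
  assumes "a \<le> b" "b \<le> u"
  shows "loglik f x u \<theta>0 \<theta>1 a = loglik f x b \<theta>0 \<theta>1 a + (\<Sum>t=b+1..u. ln (f (x t) \<theta>1))"
  using sum.ub_add_nat[of "a + 1" b "\<lambda>t. ln (f (x t) \<theta>1)" "u - b"] assms
  by (simp add: loglik_def)

lemma loglik_same_parameter:
  assumes "s \<le> u"
  shows "loglik f x u \<theta> \<theta> s = loglik_null f x u \<theta>"
  using sum.ub_add_nat[of 1 s "\<lambda>t. ln (f (x t) \<theta>)" "u - s"] assms
  by (simp add: loglik_def loglik_null_def)

lemma lr_stat_nonneg:
  assumes "lr_stat_exists f x \<Theta> H0 s u" and "H0 \<subseteq> \<Theta>" and "s \<le> u"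
  shows "0 \<le> lr_stat f x \<Theta> H0 s u"
proof -
  have alt: "has_maximum (alt_logliks f x \<Theta> H0 s u)"
    and null: "has_maximum (null_logliks f x H0 u)"
    using assms(1) by (auto simp: lr_stat_exists_def)
  have "null_logliks f x H0 u \<subseteq> alt_logliks f x \<Theta> H0 s u"
    using assms(2) loglik_same_parameter[OF assms(3), of f x, symmetric]
    by (fastforce simp: null_logliks_def alt_logliks_def)
  then have "maximum (null_logliks f x H0 u) \<le> maximum (alt_logliks f x \<Theta> H0 s u)"
    using maximum_in_and_ge(1)[OF null] maximum_in_and_ge(2)[OF alt] by blast
  then show ?thesis
    by (simp add: lr_stat_def)
qed

lemma lr_stat_triangle:
  assumes "a \<le> b" and "b \<le> u"
    and "lr_stat_exists f x \<Theta> H0 a u"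
    and "lr_stat_exists f x \<Theta> H0 a b"
    and "lr_stat_exists f x \<Theta> H0 b u"
  shows "lr_stat f x \<Theta> H0 a u \<le> lr_stat f x \<Theta> H0 a b + lr_stat f x \<Theta> H0 b u"
proof -
  note ex = assms(3-5)[unfolded lr_stat_exists_def]
  obtain \<theta>0 \<theta>1 where \<theta>: "\<theta>0 \<in> H0" "\<theta>1 \<in> \<Theta>"
    and au: "maximum (alt_logliks f x \<Theta> H0 a u) = loglik f x u \<theta>0 \<theta>1 a"
    using maximum_in_and_ge(1)[of "alt_logliks f x \<Theta> H0 a u"] ex
    by (auto simp: alt_logliks_def)
  \<comment> \<open>\<open>\<eta>\<close> may differ from \<open>\<theta>0\<close>; paired with the
    same \<open>\<theta>1\<close> it is the competitor with change at \<open>b\<close>.\<close>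
  obtain \<eta> where \<eta>: "\<eta> \<in> H0"
    and null: "maximum (null_logliks f x H0 b) = loglik_null f x b \<eta>"
    using maximum_in_and_ge(1)[of "null_logliks f x H0 b"] ex
    by (auto simp: null_logliks_def)
  have "loglik f x b \<theta>0 \<theta>1 a \<le> maximum (alt_logliks f x \<Theta> H0 a b)"
    by (rule maximum_in_and_ge(2)) (use \<theta> ex in \<open>auto simp: alt_logliks_def\<close>)
  moreover have "loglik f x u \<eta> \<theta>1 b \<le> maximum (alt_logliks f x \<Theta> H0 b u)"
    by (rule maximum_in_and_ge(2)) (use \<theta> \<eta> ex in \<open>auto simp: alt_logliks_def\<close>)
  \<comment> \<open>Three terms cancel: the tail after \<open>b\<close> under
    \<open>\<theta>1\<close>, the null value of \<open>\<eta>\<close> up to \<open>b\<close>, and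
    the null maximum at \<open>u\<close>.\<close>
  ultimately show ?thesis
    unfolding lr_stat_def au null loglik_split[OF assms(1,2)] loglik_eq_loglik_null_add[of f x u \<eta>]
    by linarith
qed

theorem proposition4:
  fixes M :: "'a measure" and f :: "'a \<Rightarrow> real \<Rightarrow> real" and \<Theta> H0 :: "real set"
    and x :: "nat \<Rightarrow> 'a" and T n :: nat and \<tau> :: "nat \<Rightarrow> nat"
  assumes "density_family M \<Theta> f"
    and "\<And>t. t \<in> {1..T} \<Longrightarrow> x t \<in> space M"
    and "\<And>t \<theta>. t \<in> {1..T} \<Longrightarrow> \<theta> \<in> \<Theta> \<Longrightarrow> f (x t) \<theta> > 0"
    and "(\<exists>\<theta>0\<in>\<Theta>. H0 = {\<theta>0}) \<or> H0 = \<Theta>"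
    and "n \<ge> 1"
    and "strict_mono_on {1..n} \<tau>"
    and "\<tau> n < T"
    and "\<And>i. i \<in> {1..n} \<Longrightarrow> lr_stat_exists f x \<Theta> H0 (\<tau> i) T"
    and "\<And>i. i \<in> {1..<n} \<Longrightarrow> lr_stat_exists f x \<Theta> H0 (\<tau> i) (\<tau> (i + 1))"
  shows "(MAX i\<in>{1..n}. lr_stat f x \<Theta> H0 (\<tau> i) T)
           \<le> (\<Sum>i=1..<n. lr_stat f x \<Theta> H0 (\<tau> i) (\<tau> (i + 1))) + lr_stat f x \<Theta> H0 (\<tau> n) T"
proof -
  let ?m = "lr_stat f x \<Theta> H0"
  have sub: "H0 \<subseteq> \<Theta>"
    using assms(4) by auto
  have tau_le: "\<tau> i \<le> \<tau> (i + 1)" if "i \<in> {1..<n}" for i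
    using strict_mono_onD[OF assms(6), of i "i + 1"] that by simp
  have below_T: "\<tau> i \<le> T" if "i \<in> {1..n}" for i
    using monotone_onD[OF strict_mono_on_imp_mono_on[OF assms(6)], of i n] that assms(7) by simp
  have chain: "?m (\<tau> i) T \<le> (\<Sum>j=i..<n. ?m (\<tau> j) (\<tau> (j + 1))) + ?m (\<tau> n) T"
    if "i \<le> n" "1 \<le> i" for i
    using that
  \<comment> \<open>Descends from \<open>n\<close>, where the sum is empty; each step splits off the
    first segment.\<close>
  proof (induction rule: inc_induct)
    case base
    then show ?case by simp
  next
    case (step k)
    have "?m (\<tau> k) T \<le> ?m (\<tau> k) (\<tau> (k + 1)) + ?m (\<tau> (k + 1)) T"
      using step.hyps step.prems
      by (intro lr_stat_triangle assms(8,9) below_T tau_le) auto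
    then show ?case
      using step by (simp add: sum.atLeast_Suc_lessThan)
  qed
  have "?m (\<tau> i) T \<le> (\<Sum>j=1..<n. ?m (\<tau> j) (\<tau> (j + 1))) + ?m (\<tau> n) T" if i: "i \<in> {1..n}" for i
  proof -
    have "(\<Sum>j=i..<n. ?m (\<tau> j) (\<tau> (j + 1))) \<le> (\<Sum>j=1..<n. ?m (\<tau> j) (\<tau> (j + 1)))"
      using i by (intro sum_mono2 lr_stat_nonneg assms(9) sub tau_le) auto
    then show ?thesis
      using chain[of i] i by simp
  qed
  \<comment> \<open>Since \<open>n \<ge> 1\<close>, the \<open>MAX\<close> ranges over a nonempty
    finite set, so bounding each member suffices.\<close>
  then show ?thesis
    using assms(5) by simp
qed

end
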